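(* For every positive integer $n$, the symmetrized Stirling matrix of second kind $\mathcal S\mathcal S^*$, where $\mathcal S$ is the $n\times n$ Stirling matrix of second kind, is totally positive.
   Context: Let $(x)_0=1$ and $(x)_k=x(x-1)\cdots(x-k+1)$ for a positive integer $k$. The Stirling numbers of second kind $S(n,k)$ are defined by $x^n=\sum_{k=0}^{n}S(n,k)(x)_k$. The $n\times n$ Stirling matrix of second kind $\mathcal S=[\mathcal S_{ij}]_{i,j=1}^{n}$ is defined by $\mathcal S_{ij}=S(i,j)$ if $i\ge j$ and $\mathcal S_{ij}=0$ otherwise. A matrix is called totally positive if all its minors are (strictly) positive. *)

theory Defs
  imports
    "HOL-Combinatorics.Stirling"
    "Jordan_Normal_Form.Schur_Decomposition"
    "Jordan_Normal_Form.DL_Submatrix"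
begin

definition falling_factorial :: "real \<Rightarrow> nat \<Rightarrow> real" where
  "falling_factorial x k = (\<Prod>i<k. x - real i)"

lemma falling_factorial_Suc:
  "falling_factorial x (Suc k) = falling_factorial x k * (x - real k)"
  by (simp add: falling_factorial_def)

lemma falling_factorial_eq_0: "k < j \<Longrightarrow> falling_factorial (real k) j = 0"
  by (auto simp: falling_factorial_def intro!: prod_zero)

lemma falling_factorial_self_neq_0: "falling_factorial (real k) k \<noteq> 0"
  by (auto simp: falling_factorial_def)

lemma power_eq_sum_Stirling:
  "x ^ n = (\<Sum>k\<le>n. real (Stirling n k) * falling_factorial x k)"
proof (induction n)
  case 0
  then show ?case by (simp add: falling_factorial_def)
next
  case (Suc n)
  let ?f = "falling_factorial x"
  have step: "x * ?f k = ?f (Suc k) + real k * ?f k" for k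
    by (simp add: falling_factorial_Suc algebra_simps)
  have shift: "(\<Sum>k\<le>n. real k * real (Stirling n k) * ?f k) =
      (\<Sum>k\<le>n. real (Suc k) * real (Stirling n (Suc k)) * ?f (Suc k))"
  proof -
    have "(\<Sum>k\<le>n. real k * real (Stirling n k) * ?f k) =
        (\<Sum>k\<le>Suc n. real k * real (Stirling n k) * ?f k)"
      by simp
    also have "\<dots> = (\<Sum>k\<le>n. real (Suc k) * real (Stirling n (Suc k)) * ?f (Suc k))"
      by (subst sum.atMost_Suc_shift) simp
    finally show ?thesis .
  qed
  have "x ^ Suc n = (\<Sum>k\<le>n. real (Stirling n k) * (x * ?f k))"
    by (simp add: Suc sum_distrib_left mult_ac)
  also have "\<dots> = (\<Sum>k\<le>n. real (Stirling n k) * ?f (Suc k)) +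
      (\<Sum>k\<le>n. real k * real (Stirling n k) * ?f k)"
    by (simp only: step distrib_left sum.distrib mult.assoc mult.left_commute)
  also have "\<dots> = (\<Sum>k\<le>n. real (Stirling (Suc n) (Suc k)) * ?f (Suc k))"
    unfolding shift sum.distrib[symmetric]
    by (intro sum.cong refl) (simp add: algebra_simps)
  also have "\<dots> = (\<Sum>k\<le>Suc n. real (Stirling (Suc n) k) * ?f k)"
    by (simp only: sum.atMost_Suc_shift) simp
  finally show ?case .
qed

text \<open>The library defines \<open>Stirling\<close> by its recurrence. The numbers \<open>Stirling n k\<close> are exactly
  the coefficients of \<open>x ^ n\<close> in the basis of falling factorials.\<close>

theorem Stirling_iff_power_expansion:
  fixes c :: "nat \<Rightarrow> real"
  shows "(\<forall>x. x ^ n = (\<Sum>k\<le>n. c k * falling_factorial x k)) \<longleftrightarrow>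
    (\<forall>k\<le>n. c k = real (Stirling n k))"
proof
  assume c: "\<forall>x. x ^ n = (\<Sum>k\<le>n. c k * falling_factorial x k)"
  define d where "d k = c k - real (Stirling n k)" for k
  have d0: "(\<Sum>k\<le>n. d k * falling_factorial x k) = 0" for x
    using c[rule_format, of x] power_eq_sum_Stirling[of x n]
    by (simp add: d_def left_diff_distrib sum_subtractf)
  have "k \<le> n \<Longrightarrow> d k = 0" for k
  proof (induction k rule: less_induct)
    case (less k)
    have "d j * falling_factorial (real k) j = 0" if "j \<le> n" "j \<noteq> k" for j
      using that less falling_factorial_eq_0[of k j] by (cases "j < k") auto
    then have "(\<Sum>j\<le>n. d j * falling_factorial (real k) j) =
        (\<Sum>j\<in>{k}. d j * falling_factorial (real k) j)"
      using less.prems by (intro sum.mono_neutral_right) auto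
    then show "d k = 0"
      using d0[of "real k"] falling_factorial_self_neq_0[of k] by simp
  qed
  then show "\<forall>k\<le>n. c k = real (Stirling n k)"
    by (simp add: d_def)
next
  assume "\<forall>k\<le>n. c k = real (Stirling n k)"
  then show "\<forall>x. x ^ n = (\<Sum>k\<le>n. c k * falling_factorial x k)"
    by (simp add: power_eq_sum_Stirling)
qed

text \<open>Matrix entries are indexed from 0, so entry \<open>(i, j)\<close> holds the Stirling number with
  indices \<open>i + 1\<close> and \<open>j + 1\<close>.\<close>

definition stirling_matrix :: "nat \<Rightarrow> real mat" where
  "stirling_matrix n =
    mat n n (\<lambda>(i, j). if i \<ge> j then real (Stirling (Suc i) (Suc j)) else 0)"

definition totally_positive :: "real mat \<Rightarrow> bool" where
  "totally_positive A \<longleftrightarrow>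
    (\<forall>I J. I \<subseteq> {..<dim_row A} \<longrightarrow> J \<subseteq> {..<dim_col A} \<longrightarrow> I \<noteq> {} \<longrightarrow> card I = card J \<longrightarrow>
      det (submatrix A I J) > 0)"

end

theory Submission
  imports Defs
begin

text \<open>
  Let \<open>S\<close> be the Stirling matrix. By \<open>Cauchy_Binet\<close> the minor of \<open>S * S\<^sup>T\<close> with rows \<open>I\<close> and
  columns \<open>J\<close> is the sum, over all column sets \<open>K\<close> of the same size \<open>k\<close>, of the products of two
  minors of \<open>S\<close>: rows \<open>I\<close>, columns \<open>K\<close>, and rows \<open>J\<close>, columns \<open>K\<close>. So it suffices that every
  minor of \<open>S\<close> is nonnegative and that for one \<open>K\<close> both minors are positive. The set
  \<open>K = {0..<k}\<close> works for all \<open>I\<close> and \<open>J\<close>, because a minor of \<open>S\<close> is positive as soon as its rows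
  dominate its columns: the \<open>j\<close>-th column index is at most the \<open>j\<close>-th row index, for all \<open>j\<close>.

  Both facts about the minors of \<open>S\<close> are \<open>stirling_minor_sign\<close>, and come from the recurrence
  \<open>Stirling (n + 1) k = k * Stirling n k + Stirling n (k - 1)\<close>. It writes each column of a minor
  as a positive combination of at most two adjacent columns, taken one row higher. Expanding all the
  columns gives a positive combination of minors one row higher, in which each column index has
  been kept or lowered by one. As the original indices increase strictly, the new ones increase
  weakly: either two of them coincide and the new minor vanishes, or they increase strictly and
  induction applies. Once the first row of the minor is the top row of \<open>S\<close>, which is
  \<open>(1, 0, 0, \<dots>)\<close>, expansion along that row gives zero or a minor of smaller size.
\<close>

section \<open>Expansion of the determinant of a product\<close>

text \<open>
  The determinant is linear in each row, so a determinant whose rows are all sums is a sum over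
  the ways \<open>f\<close> to choose one summand in each row. The index set may vary with the row: this is
  what the expansion of the Stirling minors needs, while the Cauchy--Binet formula uses a
  constant one.
\<close>

lemma det_mat_sum_rows:
  fixes A B :: "nat \<Rightarrow> nat \<Rightarrow> 'a :: comm_ring_1"
  assumes "\<And>i. i < k \<Longrightarrow> finite (S i)"
  shows "det (mat k k (\<lambda>(i, j). \<Sum>s\<in>S i. A i s * B s j)) =
    (\<Sum>f\<in>Pi\<^sub>E {0..<k} S. (\<Prod>i = 0..<k. A i (f i)) * det (mat k k (\<lambda>(i, j). B (f i) j)))"
proof -
  let ?P = "{p. p permutes {0..<k}}"
  have perm: "p i < k" if "p \<in> ?P" "i < k" for p i
    using that permutes_in_image[of p "{0..<k}" i] by simp
  have "det (mat k k (\<lambda>(i, j). \<Sum>s\<in>S i. A i s * B s j)) =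
      (\<Sum>p\<in>?P. signof p * (\<Prod>i = 0..<k. \<Sum>s\<in>S i. A i s * B s (p i)))"
    by (subst det_def'[of _ k]) (auto intro!: sum.cong prod.cong simp: perm)
  also have "\<dots> = (\<Sum>p\<in>?P. \<Sum>f\<in>Pi\<^sub>E {0..<k} S.
      (\<Prod>i = 0..<k. A i (f i)) * (signof p * (\<Prod>i = 0..<k. B (f i) (p i))))"
  proof (rule sum.cong[OF refl])
    fix p
    have "(\<Prod>i = 0..<k. \<Sum>s\<in>S i. A i s * B s (p i)) =
        (\<Sum>f\<in>Pi\<^sub>E {0..<k} S. \<Prod>i = 0..<k. A i (f i) * B (f i) (p i))"
      using assms by (intro prod_sum_PiE) auto
    then show "signof p * (\<Prod>i = 0..<k. \<Sum>s\<in>S i. A i s * B s (p i)) =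
        (\<Sum>f\<in>Pi\<^sub>E {0..<k} S.
          (\<Prod>i = 0..<k. A i (f i)) * (signof p * (\<Prod>i = 0..<k. B (f i) (p i))))"
      by (simp add: sum_distrib_left prod.distrib mult.left_commute)
  qed
  also have "\<dots> = (\<Sum>f\<in>Pi\<^sub>E {0..<k} S. \<Sum>p\<in>?P.
      (\<Prod>i = 0..<k. A i (f i)) * (signof p * (\<Prod>i = 0..<k. B (f i) (p i))))"
    by (rule sum.swap)
  also have "\<dots> = (\<Sum>f\<in>Pi\<^sub>E {0..<k} S.
      (\<Prod>i = 0..<k. A i (f i)) * det (mat k k (\<lambda>(i, j). B (f i) j)))"
  proof (rule sum.cong[OF refl])
    fix f
    have "det (mat k k (\<lambda>(i, j). B (f i) j)) = (\<Sum>p\<in>?P. signof p * (\<Prod>i = 0..<k. B (f i) (p i)))"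
      by (subst det_def'[of _ k]) (auto intro!: sum.cong prod.cong simp: perm)
    then show "(\<Sum>p\<in>?P. (\<Prod>i = 0..<k. A i (f i)) * (signof p * (\<Prod>i = 0..<k. B (f i) (p i)))) =
      (\<Prod>i = 0..<k. A i (f i)) * det (mat k k (\<lambda>(i, j). B (f i) j))"
      by (simp add: sum_distrib_left)
  qed
  finally show ?thesis .
qed

lemma det_repeated_row_selection:
  fixes B :: "nat \<Rightarrow> nat \<Rightarrow> 'a :: comm_ring_1"
  assumes "i < k" "j < k" "i \<noteq> j" "f i = f j"
  shows "det (mat k k (\<lambda>(i, j). B (f i) j)) = 0"
  using assms by (intro det_identical_rows[of _ k i j]) (auto intro!: eq_vecI)

lemma strict_mono_on_pick: "strict_mono_on {0..<card K} (pick K)"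
  by (auto intro!: strict_mono_onI pick_mono_le)

lemma bij_betw_pick:
  assumes "finite K"
  shows "bij_betw (pick K) {0..<card K} K"
proof -
  have inj: "inj_on (pick K) {0..<card K}"
    by (rule strict_mono_on_imp_inj_on[OF strict_mono_on_pick])
  have sub: "pick K ` {0..<card K} \<subseteq> K"
    by (auto intro: pick_in_set_le)
  have "pick K ` {0..<card K} = K"
    by (rule card_subset_eq[OF assms sub]) (simp add: card_image[OF inj])
  with inj show ?thesis by (simp add: bij_betw_def)
qed

text \<open>
  In the expansion by \<open>det_mat_sum_rows\<close> only injective choices \<open>f\<close> survive. They are grouped by
  their image \<open>K\<close>: the choices with image \<open>K\<close> are the increasing enumeration \<open>pick K\<close> composed with
  a permutation \<open>p\<close>, and permuting the rows of the second factor produces the sign of \<open>p\<close>. What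
  remains in each group is the Leibniz formula for the first factor.
\<close>

theorem Cauchy_Binet:
  fixes A B :: "nat \<Rightarrow> nat \<Rightarrow> 'a :: comm_ring_1"
  shows "det (mat k k (\<lambda>(i, j). \<Sum>s<n. A i s * B s j)) =
    (\<Sum>K | K \<subseteq> {..<n} \<and> card K = k.
      det (mat k k (\<lambda>(i, j). A i (pick K j))) * det (mat k k (\<lambda>(i, j). B (pick K i) j)))"
proof -
  let ?F = "{0..<k} \<rightarrow>\<^sub>E {..<n}"
  let ?I = "{f \<in> ?F. inj_on f {0..<k}}"
  let ?C = "{K. K \<subseteq> {..<n} \<and> card K = k}"
  let ?P = "{p. p permutes {0..<k}}"
  let ?t = "\<lambda>f. (\<Prod>i = 0..<k. A i (f i)) * det (mat k k (\<lambda>(i, j). B (f i) j))"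
  have finF: "finite ?F" by (simp add: finite_PiE)
  have "det (mat k k (\<lambda>(i, j). \<Sum>s<n. A i s * B s j)) = sum ?t ?F"
    by (rule det_mat_sum_rows) simp
  also have "\<dots> = sum ?t ?I"
  proof (rule sum.mono_neutral_right[OF finF])
    show "\<forall>f\<in>?F - ?I. ?t f = 0"
    proof
      fix f assume "f \<in> ?F - ?I"
      then obtain i j where "i < k" "j < k" "i \<noteq> j" "f i = f j"
        by (auto simp: inj_on_def)
      then show "?t f = 0" by (simp add: det_repeated_row_selection)
    qed
  qed auto
  also have "\<dots> = (\<Sum>K\<in>?C. sum ?t {f \<in> ?I. f ` {0..<k} = K})"
  proof (rule sum.group[symmetric])
    show "finite ?I" using finF by simp
    show "finite ?C" by simp
    show "(\<lambda>f. f ` {0..<k}) ` ?I \<subseteq> ?C" by (auto simp: card_image)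
  qed
  also have "\<dots> = (\<Sum>K\<in>?C.
      det (mat k k (\<lambda>(i, j). A i (pick K j))) * det (mat k k (\<lambda>(i, j). B (pick K i) j)))"
  proof (rule sum.cong[OF refl])
    fix K assume "K \<in> ?C"
    then have K: "K \<subseteq> {..<n}" and card: "card K = k" by auto
    have bij: "bij_betw (pick K) {0..<k} K"
      using bij_betw_pick[of K] K card finite_subset by blast
    \<comment> \<open>The two directions of the correspondence between permutations and choices with image \<open>K\<close>;
      the values outside \<open>{0..<k}\<close> are those required by \<open>PiE\<close> and by \<open>permutes\<close>.\<close>
    define g where "g p = restrict (pick K \<circ> p) {0..<k}" for p :: "nat \<Rightarrow> nat"
    define h where "h f i = (if i < k then inv_into {0..<k} (pick K) (f i) else i)"
      for f :: "nat \<Rightarrow> nat" and i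
    have "sum ?t {f \<in> ?I. f ` {0..<k} = K} = (\<Sum>p\<in>?P. ?t (g p))"
    proof (rule sum.reindex_bij_witness[where i = g and j = h])
      fix p assume p: "p \<in> ?P"
      then have pk: "p i < k" if "i < k" for i
        using that permutes_in_image[of p "{0..<k}" i] by simp
      have pbij: "bij_betw p {0..<k} {0..<k}"
        using p by (simp add: permutes_imp_bij)
      have gbij: "bij_betw (g p) {0..<k} K"
        unfolding g_def bij_betw_restrict_eq by (rule bij_betw_trans[OF pbij bij])
      then show "g p \<in> {f \<in> ?I. f ` {0..<k} = K}"
        using K by (fastforce simp: bij_betw_def g_def)
      show "h (g p) = p"
        using p bij pk by (auto simp: h_def g_def fun_eq_iff bij_betw_def inv_into_f_f permutes_not_in)
    next
      fix f assume f: "f \<in> {f \<in> ?I. f ` {0..<k} = K}"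
      then have fbij: "bij_betw f {0..<k} K" by (auto simp: bij_betw_def)
      have "bij_betw (inv_into {0..<k} (pick K) \<circ> f) {0..<k} {0..<k}"
        by (rule bij_betw_trans[OF fbij bij_betw_inv_into[OF bij]])
      then have "bij_betw (h f) {0..<k} {0..<k}"
        by (rule bij_betw_cong[THEN iffD1, rotated]) (simp add: h_def)
      then show "h f \<in> ?P"
        by (auto intro!: bij_imp_permutes simp: h_def)
      show gh: "g (h f) = f"
      proof
        fix i
        show "g (h f) i = f i"
        proof (cases "i < k")
          case True
          with f bij have "f i \<in> pick K ` {0..<k}" by (auto simp: bij_betw_def)
          with True show ?thesis by (simp add: g_def h_def f_inv_into_f)
        next
          case False
          with f show ?thesis by (auto simp: g_def PiE_def extensional_def)
        qed
      qed
      then show "?t (g (h f)) = ?t f" by simp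
    qed
    also have "\<dots> = (\<Sum>p\<in>?P. signof p * (\<Prod>i = 0..<k. A i (pick K (p i))) *
        det (mat k k (\<lambda>(i, j). B (pick K i) j)))"
    proof (rule sum.cong[OF refl])
      fix p assume p: "p \<in> ?P"
      then have pk: "p i < k" if "i < k" for i
        using that permutes_in_image[of p "{0..<k}" i] by simp
      have "mat k k (\<lambda>(i, j). B (g p i) j) =
          mat k k (\<lambda>(i, j). mat k k (\<lambda>(i, j). B (pick K i) j) $$ (p i, j))"
        by (rule eq_matI) (auto simp: g_def pk)
      then have "det (mat k k (\<lambda>(i, j). B (g p i) j)) =
          signof p * det (mat k k (\<lambda>(i, j). B (pick K i) j))"
        using p by (simp add: det_permute_rows)
      moreover have "(\<Prod>i = 0..<k. A i (g p i)) = (\<Prod>i = 0..<k. A i (pick K (p i)))"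
        by (simp add: g_def)
      ultimately show "?t (g p) = signof p * (\<Prod>i = 0..<k. A i (pick K (p i))) *
          det (mat k k (\<lambda>(i, j). B (pick K i) j))"
        by (simp add: mult_ac)
    qed
    also have "(\<Sum>p\<in>?P. signof p * (\<Prod>i = 0..<k. A i (pick K (p i))) *
        det (mat k k (\<lambda>(i, j). B (pick K i) j))) =
      det (mat k k (\<lambda>(i, j). A i (pick K j))) * det (mat k k (\<lambda>(i, j). B (pick K i) j))"
    proof -
      have "p i < k" if "p \<in> ?P" "i < k" for p i
        using that permutes_in_image[of p "{0..<k}" i] by simp
      then have "det (mat k k (\<lambda>(i, j). A i (pick K j))) =
          (\<Sum>p\<in>?P. signof p * (\<Prod>i = 0..<k. A i (pick K (p i))))"
        by (subst det_def'[of _ k]) (auto intro!: sum.cong prod.cong)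
      then show ?thesis by (simp add: sum_distrib_right)
    qed
    finally show "sum ?t {f \<in> ?I. f ` {0..<k} = K} =
      det (mat k k (\<lambda>(i, j). A i (pick K j))) * det (mat k k (\<lambda>(i, j). B (pick K i) j))" .
  qed
  finally show ?thesis .
qed

section \<open>Minors of the Stirling triangle\<close>

text \<open>
  The matrix is written in transposed form, with row index \<open>j\<close> running through the columns \<open>c\<close>, so that the expansion
  of the columns of the Stirling triangle becomes an expansion of rows and \<open>det_mat_sum_rows\<close>
  applies.
\<close>

definition stirling_minor :: "nat \<Rightarrow> (nat \<Rightarrow> nat) \<Rightarrow> (nat \<Rightarrow> nat) \<Rightarrow> real" where
  "stirling_minor k r c = det (mat k k (\<lambda>(j, i). real (Stirling (Suc (r i)) (Suc (c j)))))"

text \<open>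
  The recurrence, in a form in which all weights are positive. For \<open>t = 0\<close> the index set collapses
  to \<open>{0}\<close>, in accordance with the vanishing of \<open>Stirling (Suc m) 0\<close>.
\<close>

lemma Stirling_Suc_weighted:
  "real (Stirling (Suc (Suc m)) (Suc t)) =
    (\<Sum>s\<in>{t - 1, t}. (if s = t then real t + 1 else 1) * real (Stirling (Suc m) (Suc s)))"
  by (cases t) (auto simp: algebra_simps simp del: Stirling.simps(4) simp: Stirling.simps(4)[of "Suc m"])

lemma stirling_minor_Suc_rows:
  assumes r: "\<And>i. i < k \<Longrightarrow> r i > 0"
  shows "stirling_minor k r c =
    (\<Sum>f\<in>Pi\<^sub>E {0..<k} (\<lambda>j. {c j - 1, c j}).
      (\<Prod>j = 0..<k. if f j = c j then real (c j) + 1 else 1) * stirling_minor k (\<lambda>i. r i - 1) f)"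
proof -
  have "stirling_minor k r c = det (mat k k (\<lambda>(j, i). \<Sum>s\<in>{c j - 1, c j}.
      (if s = c j then real (c j) + 1 else 1) * real (Stirling (Suc (r i - 1)) (Suc s))))"
    unfolding stirling_minor_def
  proof (intro arg_cong[where f = det] eq_matI)
    fix j i assume "j < dim_row (mat k k (\<lambda>(j, i). \<Sum>s\<in>{c j - 1, c j}.
      (if s = c j then real (c j) + 1 else 1) * real (Stirling (Suc (r i - 1)) (Suc s))))"
     "i < dim_col (mat k k (\<lambda>(j, i). \<Sum>s\<in>{c j - 1, c j}.
      (if s = c j then real (c j) + 1 else 1) * real (Stirling (Suc (r i - 1)) (Suc s))))"
    then have "j < k" "i < k" by simp_all
    moreover have "Suc (r i) = Suc (Suc (r i - 1))" using r[OF \<open>i < k\<close>] by simp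
    ultimately show "mat k k (\<lambda>(j, i). real (Stirling (Suc (r i)) (Suc (c j)))) $$ (j, i) =
      mat k k (\<lambda>(j, i). \<Sum>s\<in>{c j - 1, c j}.
      (if s = c j then real (c j) + 1 else 1) * real (Stirling (Suc (r i - 1)) (Suc s))) $$ (j, i)"
      by (simp only: index_mat split Stirling_Suc_weighted)
  qed simp_all
  then show ?thesis
    unfolding stirling_minor_def
    using det_mat_sum_rows[of k "\<lambda>j. {c j - 1, c j}" "\<lambda>j s. if s = c j then real (c j) + 1 else 1"
      "\<lambda>s i. real (Stirling (Suc (r i - 1)) (Suc s))"] by simp
qed

text \<open>
  The top row of the triangle is \<open>(1, 0, 0, \<dots>)\<close>, and in a strictly increasing family of columns
  only the first can have index \<open>0\<close>; hence Laplace expansion along the top row has at most one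
  nonzero term.
\<close>

lemma stirling_minor_row_zero:
  assumes r: "r 0 = 0" and c: "strict_mono_on {0..<Suc k} c"
  shows "stirling_minor (Suc k) r c =
    (if c 0 = 0 then stirling_minor k (r \<circ> Suc) (c \<circ> Suc) else 0)"
proof -
  let ?A = "mat (Suc k) (Suc k) (\<lambda>(j, i). real (Stirling (Suc (r i)) (Suc (c j))))"
  have entry: "?A $$ (j, 0) = (if j = 0 \<and> c 0 = 0 then 1 else 0)" if "j < Suc k" for j
  proof (cases j)
    case 0
    then show ?thesis using r by (cases "c 0") auto
  next
    case (Suc j')
    then have "c 0 < c j" using that c by (auto simp: strict_mono_on_def)
    then show ?thesis using Suc that r by simp
  qed
  have "stirling_minor (Suc k) r c = (\<Sum>j<Suc k. ?A $$ (j, 0) * cofactor ?A j 0)"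
    unfolding stirling_minor_def by (rule laplace_expansion_column) auto
  also have "\<dots> = (\<Sum>j<Suc k. (if j = 0 \<and> c 0 = 0 then 1 else 0) * cofactor ?A j 0)"
    using entry by (intro sum.cong) simp_all
  also have "\<dots> = (if c 0 = 0 then cofactor ?A 0 0 else 0)"
    by (subst sum.lessThan_Suc_shift) (simp del: sum.lessThan_Suc Stirling.simps)
  also have "cofactor ?A 0 0 = stirling_minor k (r \<circ> Suc) (c \<circ> Suc)"
    unfolding cofactor_def stirling_minor_def
    by (auto intro!: arg_cong[where f = det] eq_matI simp: mat_delete_def)
  finally show ?thesis .
qed

text \<open>
  Induction on the size and, for a fixed size, on the first row index. For positivity it is enough
  to exhibit one positive term in \<open>stirling_minor_Suc_rows\<close>.
\<close>

theorem stirling_minor_sign: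
  assumes "strict_mono_on {0..<k} r" and "strict_mono_on {0..<k} c"
  shows "0 \<le> stirling_minor k r c"
    and "(\<And>j. j < k \<Longrightarrow> c j \<le> r j) \<Longrightarrow> 0 < stirling_minor k r c"
proof -
  have "0 \<le> stirling_minor k r c \<and> ((\<forall>j<k. c j \<le> r j) \<longrightarrow> 0 < stirling_minor k r c)"
    using assms
  proof (induction k arbitrary: r c)
    case 0
    then show ?case by (simp add: stirling_minor_def)
  next
    case (Suc k)
    show ?case
      using Suc.prems
    proof (induction "r 0" arbitrary: r c)
      case 0
      have "strict_mono_on {0..<k} (r \<circ> Suc)" "strict_mono_on {0..<k} (c \<circ> Suc)"
        using "0.prems" by (auto simp: strict_mono_on_def)
      from Suc.IH[OF this] show ?case
        using stirling_minor_row_zero[of r k c, OF "0.hyps"[symmetric] "0.prems"(2)] "0.hyps"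
        by (auto simp: comp_def)
    next
      case (Suc m)
      let ?k = "Suc k"
      let ?r = "\<lambda>i. r i - 1"
      let ?F = "Pi\<^sub>E {0..<?k} (\<lambda>j. {c j - 1, c j})"
      let ?w = "\<lambda>f. \<Prod>j = 0..<?k. if f j = c j then real (c j) + 1 else 1"
      have r_pos: "r i > 0" if "i < ?k" for i
      proof (cases "i = 0")
        case False
        then have "r 0 < r i" using that Suc.prems(1) by (auto simp: strict_mono_on_def)
        then show ?thesis by simp
      qed (use Suc.hyps(2) in simp)
      have r_mono: "strict_mono_on {0..<?k} ?r"
      proof (rule strict_mono_onI)
        fix i j assume ij: "i \<in> {0..<?k}" "j \<in> {0..<?k}" "i < j"
        then have "r i < r j" using Suc.prems(1) by (auto simp: strict_mono_on_def)
        then show "?r i < ?r j" using r_pos[of i] ij by simp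
      qed
      have m: "m = ?r 0" using Suc.hyps(2) by simp
      note IH = Suc.hyps(1)[OF m r_mono]
      have w_pos: "?w f > 0" for f by (intro prod_pos) auto
      have nonneg: "0 \<le> stirling_minor ?k ?r f" if f: "f \<in> ?F" for f
      proof -
        have mono: "f i \<le> f j" if "i < j" "j < ?k" for i j
        proof -
          have "c i < c j" using that Suc.prems(2) by (auto simp: strict_mono_on_def)
          moreover have "f i \<in> {c i - 1, c i}" "f j \<in> {c j - 1, c j}"
            using f that by (auto simp: PiE_iff)
          ultimately show ?thesis by auto
        qed
        show ?thesis
        proof (cases "strict_mono_on {0..<?k} f")
          case True
          then show ?thesis using IH by blast
        next
          case False
          then obtain i j where "i < j" "j < ?k" "\<not> f i < f j"
            by (auto simp: strict_mono_on_def)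
          with mono[of i j] have "f i = f j" by simp
          with \<open>i < j\<close> \<open>j < ?k\<close> have "stirling_minor ?k ?r f = 0"
            unfolding stirling_minor_def
            using det_repeated_row_selection[of i ?k j f "\<lambda>s i. real (Stirling (Suc (?r i)) (Suc s))"]
            by simp
          then show ?thesis by simp
        qed
      qed
      have expand: "stirling_minor ?k r c = (\<Sum>f\<in>?F. ?w f * stirling_minor ?k ?r f)"
        by (rule stirling_minor_Suc_rows) (rule r_pos)
      have terms: "0 \<le> ?w f * stirling_minor ?k ?r f" if "f \<in> ?F" for f
        using nonneg[OF that] less_imp_le[OF w_pos[of f]] by (rule mult_nonneg_nonneg[rotated])
      have "0 < stirling_minor ?k r c" if le: "\<forall>j<?k. c j \<le> r j"
      proof -
        \<comment> \<open>A column index is lowered only when \<open>c j = r j\<close>, that is, when keeping it would violate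
          the domination by the lowered row index \<open>r j - 1\<close>. As a minimum of two strictly
          increasing functions, \<open>f\<close> is strictly increasing.\<close>
        define f where "f = restrict (\<lambda>j. min (c j) (r j - 1)) {0..<?k}"
        have fF: "f \<in> ?F"
        proof (rule PiE_I)
          fix j assume j: "j \<in> {0..<?k}"
          then have "c j \<le> r j" using le by simp
          then show "f j \<in> {c j - 1, c j}" using j by (auto simp: f_def min_def)
        qed (simp add: f_def)
        have f_mono: "strict_mono_on {0..<?k} f"
        proof (rule strict_mono_onI)
          fix i j assume ij: "i \<in> {0..<?k}" "j \<in> {0..<?k}" "i < j"
          then have "c i < c j" "r i - 1 < r j - 1"
            using Suc.prems(2) r_mono by (auto simp: strict_mono_on_def)
          then show "f i < f j" using ij by (auto simp: f_def min_def)
        qed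
        have "\<forall>j<?k. f j \<le> ?r j" by (simp add: f_def)
        then have "0 < ?w f * stirling_minor ?k ?r f"
          using IH[OF f_mono] w_pos[of f] by simp
        then show ?thesis
          unfolding expand using fF terms by (intro sum_pos2[of ?F f]) (auto intro!: finite_PiE)
      qed
      moreover have "0 \<le> stirling_minor ?k r c"
        unfolding expand using terms by (rule sum_nonneg)
      ultimately show ?case by blast
    qed
  qed
  then show "0 \<le> stirling_minor k r c"
    and "(\<And>j. j < k \<Longrightarrow> c j \<le> r j) \<Longrightarrow> 0 < stirling_minor k r c" by auto
qed

section \<open>The symmetrized Stirling matrix\<close>

lemma strict_mono_on_ge_self:
  fixes f :: "nat \<Rightarrow> nat"
  assumes "strict_mono_on {0..<k} f" "j < k"
  shows "j \<le> f j"
  using assms(2)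
proof (induction j)
  case (Suc j)
  then have "f j < f (Suc j)" using assms(1) by (auto simp: strict_mono_on_def)
  with Suc show ?case by simp
qed simp

lemma symmetrized_stirling_matrix_index:
  assumes "i < n" "j < n"
  shows "(stirling_matrix n * mat_adjoint (stirling_matrix n)) $$ (i, j) =
    (\<Sum>s<n. real (Stirling (Suc i) (Suc s)) * real (Stirling (Suc j) (Suc s)))"
proof -
  have entry: "stirling_matrix n $$ (i, s) = real (Stirling (Suc i) (Suc s))"
    if "i < n" "s < n" for i s
    using that by (simp add: stirling_matrix_def)
  have adj: "mat_adjoint (stirling_matrix n) $$ (s, j) = real (Stirling (Suc j) (Suc s))"
    if "j < n" "s < n" for j s
    using that entry[OF that]
    by (simp add: mat_adjoint_def mat_of_rows_def stirling_matrix_def)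
  have dims: "dim_row (stirling_matrix n) = n" "dim_col (stirling_matrix n) = n"
    "dim_row (mat_adjoint (stirling_matrix n)) = n" "dim_col (mat_adjoint (stirling_matrix n)) = n"
    by (simp_all add: stirling_matrix_def mat_adjoint_def)
  show ?thesis
    using assms
    by (auto simp: scalar_prod_def dims entry adj atLeast0LessThan intro!: sum.cong)
qed

theorem theorem3p4:
  fixes n :: nat
  assumes "n > 0"
  shows "totally_positive (stirling_matrix n * mat_adjoint (stirling_matrix n))"
  unfolding totally_positive_def
proof (intro allI impI)
  let ?G = "stirling_matrix n * mat_adjoint (stirling_matrix n)"
  let ?s = "\<lambda>i j. real (Stirling (Suc i) (Suc j))"
  fix I J :: "nat set"
  assume IJ: "I \<subseteq> {..<dim_row ?G}" "J \<subseteq> {..<dim_col ?G}" and card_eq: "card I = card J"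
  define k where "k = card I"
  have I: "I \<subseteq> {..<n}" "card I = k" and J: "J \<subseteq> {..<n}" "card J = k"
    using IJ card_eq by (simp_all add: k_def stirling_matrix_def mat_adjoint_def)
  have k_le: "k \<le> n" using card_mono[OF _ I(1)] I(2) by simp
  have pick_less: "pick L i < n" if "L \<subseteq> {..<n}" "card L = k" "i < k" for L i
    using that pick_in_set_le[of i L] by auto
  have pick_mono: "strict_mono_on {0..<k} (pick L)" if "card L = k" for L
    using strict_mono_on_pick[of L] that by simp
  have dims: "dim_row ?G = n" "dim_col ?G = n"
    by (simp_all add: stirling_matrix_def mat_adjoint_def)
  have "{i. i < n \<and> i \<in> I} = I" "{j. j < n \<and> j \<in> J} = J" using I J by auto
  then have sub: "submatrix ?G I J =
      mat k k (\<lambda>(i, j). \<Sum>s<n. ?s (pick I i) s * ?s (pick J j) s)"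
    unfolding submatrix_def dims using I J
    by (intro eq_matI) (simp_all add: symmetrized_stirling_matrix_index pick_less del: index_mult_mat)
  have "det (submatrix ?G I J) = (\<Sum>K | K \<subseteq> {..<n} \<and> card K = k.
      det (mat k k (\<lambda>(i, j). ?s (pick I i) (pick K j))) *
      det (mat k k (\<lambda>(i, j). ?s (pick J j) (pick K i))))"
    unfolding sub by (rule Cauchy_Binet)
  also have "\<dots> = (\<Sum>K | K \<subseteq> {..<n} \<and> card K = k.
      stirling_minor k (pick I) (pick K) * stirling_minor k (pick J) (pick K))"
  proof (rule sum.cong[OF refl])
    fix K
    have "mat k k (\<lambda>(i, j). ?s (pick I i) (pick K j)) =
        transpose_mat (mat k k (\<lambda>(j, i). ?s (pick I i) (pick K j)))"
      by (rule eq_matI) (simp_all del: Stirling.simps)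
    then have "det (mat k k (\<lambda>(i, j). ?s (pick I i) (pick K j))) =
        stirling_minor k (pick I) (pick K)"
      by (simp add: stirling_minor_def det_transpose[of _ k] del: Stirling.simps)
    then show "det (mat k k (\<lambda>(i, j). ?s (pick I i) (pick K j))) *
        det (mat k k (\<lambda>(i, j). ?s (pick J j) (pick K i))) =
      stirling_minor k (pick I) (pick K) * stirling_minor k (pick J) (pick K)"
      by (simp add: stirling_minor_def del: Stirling.simps)
  qed
  also have "\<dots> > 0"
  proof (rule sum_pos2[of _ "{0..<k}"])
    show "finite {K. K \<subseteq> {..<n} \<and> card K = k}" by simp
    show "{0..<k} \<in> {K. K \<subseteq> {..<n} \<and> card K = k}" using k_le by auto
    have "pick {0..<k} j = j" if "j < k" for j
    proof -
      have "{a \<in> {0..<k}. a < j} = {0..<j}" using that by auto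
      then show ?thesis using pick_card_in_set[of j "{0..<k}"] that by simp
    qed
    then have "0 < stirling_minor k (pick L) (pick {0..<k})" if "card L = k" for L
      using that pick_mono[OF that] pick_mono[of "{0..<k}"]
      by (intro stirling_minor_sign(2)) (simp_all add: strict_mono_on_ge_self)
    then show "0 < stirling_minor k (pick I) (pick {0..<k}) * stirling_minor k (pick J) (pick {0..<k})"
      using I J by simp
    fix K assume "K \<in> {K. K \<subseteq> {..<n} \<and> card K = k}"
    then have "card K = k" by simp
    then show "0 \<le> stirling_minor k (pick I) (pick K) * stirling_minor k (pick J) (pick K)"
      using I(2) J(2) by (intro mult_nonneg_nonneg stirling_minor_sign(1) pick_mono)
  qed
  finally show "det (submatrix ?G I J) > 0" .
qed

end
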